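(* Let $H\in(0,1)$, let $Z$ be an offspring distribution with $m:=\mathbb{E}[Z]>1$, and let $Y$ be a real-valued random variable. Suppose there exists $q>\max\{1/H,1\}$ such that $\mathbb{E}[Z^q]<\infty$, and suppose $\mathbb{E}[|Y|^{1/H}]<\infty$. Then the discounted branching random walk $\{X_t\}_{t\in\mathcal{T}}$ with offspring distribution $Z$, increment law $Y$ and discounting factor $H$ satisfies $\mathbb{E}\big[\sup_{t\in\mathcal{T}}|X_t|\big]<\infty$.
   Context: Consider a Galton--Watson tree with offspring distribution $Z$ (a random variable with values in $\{0,1,2,\dots\}$) with $m=\mathbb{E}[Z]>1$. $\mathcal{T}$ is the set of rays, i.e. infinite paths from the root to the boundary of the tree. $V_n$ is the set of vertices at distance $n$ from the root, and $V=\bigcup_{n\ge1}V_n$ is the set of non-root vertices. To the vertices $v\in V$ are attached i.i.d. real random variables $\eta_v$ with the law of $Y$, independent of the tree. For a ray $t\in\mathcal{T}$ and $i\ge1$, $t_i$ is the unique vertex of $V_i$ on $t$. The discounted branching random walk is $$X_t:=\sum_{i\ge1}m^{-iH}\eta_{t_i},\qquad t\in\mathcal{T}.$$ If $\mathcal{T}$ is empty, $\sup_{t\in\mathcal{T}}X_t=\sup_{t\in\mathcal{T}}|X_t|=0$ by convention. *)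

theory Defs
  imports "HOL-Probability.Probability"
begin

text \<open>
  Vertices carry Ulam--Harris labels: the root is \<^term>\<open>[]\<close> and a vertex \<open>v\<close> with
  \<open>c v\<close> children has the children \<open>v @ [k]\<close> for \<open>k < c v\<close>. The generation of a vertex
  is its length.
\<close>

inductive_set gw_tree :: "(nat list \<Rightarrow> nat) \<Rightarrow> nat list set"
  for c :: "nat list \<Rightarrow> nat"
where
  root: "[] \<in> gw_tree c"
| child: "v \<in> gw_tree c \<Longrightarrow> k < c v \<Longrightarrow> v @ [k] \<in> gw_tree c"

text \<open>A ray \<open>t\<close> is the sequence of its vertices, so \<open>t i\<close> is its vertex of generation \<open>i\<close>.\<close>

definition rays :: "(nat list \<Rightarrow> nat) \<Rightarrow> (nat \<Rightarrow> nat list) set" where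
  "rays c = {t. t 0 = [] \<and> (\<forall>i. t i \<in> gw_tree c \<and> (\<exists>k. t (Suc i) = t i @ [k]))}"

definition offspring_mean :: "nat pmf \<Rightarrow> real" where
  "offspring_mean Z = measure_pmf.expectation Z real"

text \<open>
  Every label carries an offspring number and every label other than the root an increment,
  whether or not the label is a vertex of the realised tree. The parameter \<open>L\<close> is the
  increment law, and the last assumption says that the tree is independent of the increments.
\<close>

locale discounted_brw = prob_space M
  for M :: "'a measure" and Z :: "nat pmf" and L :: "real measure"
    and N :: "nat list \<Rightarrow> 'a \<Rightarrow> nat" and \<eta> :: "nat list \<Rightarrow> 'a \<Rightarrow> real" +
  assumes offspring_indep: "indep_vars (\<lambda>_. count_space UNIV) N UNIV"
    and offspring_law: "\<And>v. distr M (count_space UNIV) (N v) = measure_pmf Z"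
    and increments_indep: "indep_vars (\<lambda>_. borel) \<eta> {v. v \<noteq> []}"
    and increments_law: "\<And>v. v \<noteq> [] \<Longrightarrow> distr M borel (\<eta> v) = L"
    and tree_indep_increments:
      "indep_var (Pi\<^sub>M UNIV (\<lambda>_. count_space UNIV)) (\<lambda>\<omega>. \<lambda>v\<in>UNIV. N v \<omega>)
                 (Pi\<^sub>M {v. v \<noteq> []} (\<lambda>_. borel)) (\<lambda>\<omega>. \<lambda>v\<in>{v. v \<noteq> []}. \<eta> v \<omega>)"

text \<open>
  The term of index \<open>i\<close> below belongs to generation \<open>Suc i\<close>: the root does not contribute.
\<close>

definition brw_term :: "nat pmf \<Rightarrow> real \<Rightarrow> (nat list \<Rightarrow> real) \<Rightarrow> (nat \<Rightarrow> nat list) \<Rightarrow> nat \<Rightarrow> real" where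
  "brw_term Z H y t i = offspring_mean Z powr (- (real (Suc i) * H)) * y (t (Suc i))"

definition brw_value :: "nat pmf \<Rightarrow> real \<Rightarrow> (nat list \<Rightarrow> real) \<Rightarrow> (nat \<Rightarrow> nat list) \<Rightarrow> real" where
  "brw_value Z H y t = (\<Sum>i. brw_term Z H y t i)"

text \<open>The supremum over an empty set of rays is \<open>0\<close>, the least element of \<^typ>\<open>ennreal\<close>.\<close>

definition brw_sup_abs ::
  "nat pmf \<Rightarrow> real \<Rightarrow> (nat list \<Rightarrow> nat) \<Rightarrow> (nat list \<Rightarrow> real) \<Rightarrow> ennreal" where
  "brw_sup_abs Z H c y = (SUP t\<in>rays c. ennreal \<bar>brw_value Z H y t\<bar>)"

end

theory Submission
  imports Defs
begin

text \<open>
  Let \<open>W v = m\<^sup>-\<^sup>i\<^sup>H |\<eta> v|\<close> for \<open>v\<close> of generation \<open>i\<close>, and call \<open>v\<close> marked at level \<open>u\<close> if \<open>u < W v\<close>.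
  The sum of \<open>W\<close> along a path is the integral over \<open>u > 0\<close> of the number of its marks at level \<open>u\<close>,
  so it suffices to bound the expectation of the largest number \<open>K u\<close> of marks on a path.
  The expected number of all marks in the tree is at most \<open>B u = C u powr (- 1 / H)\<close>, because
  \<open>E |Y| powr (1 / H)\<close> is finite; this is integrable at infinity since \<open>H < 1\<close>. For small \<open>u\<close>
  the expected number of pairs of marks on a common path beyond generation \<open>2 log m (B u)\<close> is
  bounded, which makes \<open>E (K u)\<close> logarithmic in \<open>u\<close>. Counting only marks beyond generation \<open>n\<close>
  and applying dominated convergence shows that the tails of the sums vanish uniformly in the
  ray, which also yields measurability of the supremum.
\<close>

subsection \<open>Vertices and rays\<close>

text \<open>Turns membership into finitely many conditions on the offspring numbers of the proper
  prefixes; measurability and the probability of membership both rest on this form.\<close>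

lemma gw_tree_iff: "v \<in> gw_tree c \<longleftrightarrow> (\<forall>j<length v. v ! j < c (take j v))"
proof (induction v rule: rev_induct)
  case Nil
  show ?case by (simp add: gw_tree.root)
next
  case (snoc k v)
  have "v @ [k] \<in> gw_tree c \<longleftrightarrow> v \<in> gw_tree c \<and> k < c v"
    by (auto intro: gw_tree.child elim: gw_tree.cases)
  also have "\<dots> \<longleftrightarrow> (\<forall>j<length (v @ [k]). (v @ [k]) ! j < c (take j (v @ [k])))"
    unfolding snoc.IH by (auto simp: less_Suc_eq nth_append)
  finally show ?case .
qed

lemma take_in_gw_tree: "v \<in> gw_tree c \<Longrightarrow> take i v \<in> gw_tree c"
  by (auto simp: gw_tree_iff min_def)

lemma rays_length: "t \<in> rays c \<Longrightarrow> length (t i) = i"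
proof (induction i)
  case (Suc i)
  obtain k where "t (Suc i) = t i @ [k]" using Suc.prems by (auto simp: rays_def)
  then show ?case using Suc by simp
qed (simp add: rays_def)

lemma rays_take:
  assumes "t \<in> rays c" "i \<le> n"
  shows "take i (t n) = t i"
  using assms(2)
proof (induction n rule: dec_induct)
  case base
  show ?case using rays_length[OF assms(1), of i] by simp
next
  case (step n)
  obtain k where "t (Suc n) = t n @ [k]" using assms(1) by (auto simp: rays_def)
  then show ?case using step rays_length[OF assms(1), of n] by simp
qed

text \<open>Stands in for the existence of a ray through \<open>v\<close>, but involves only
  countably many conditions, so it is measurable in the offspring numbers. The case
  \<open>k = 0\<close> puts \<open>v\<close> itself in the tree.\<close>

definition survives :: "(nat list \<Rightarrow> nat) \<Rightarrow> nat list \<Rightarrow> bool" where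
  "survives c v \<longleftrightarrow> (\<forall>k. \<exists>w. length w = k \<and> v @ w \<in> gw_tree c)"

lemma ray_survives:
  assumes "t \<in> rays c"
  shows "survives c (t n)"
  unfolding survives_def
proof
  fix k
  have "t n = take n (t (n + k))" using rays_take[OF assms, of n "n + k"] by simp
  then have "t n @ drop n (t (n + k)) = t (n + k)" by simp
  moreover have "t (n + k) \<in> gw_tree c" using assms by (simp add: rays_def)
  ultimately show "\<exists>w. length w = k \<and> t n @ w \<in> gw_tree c"
    using rays_length[OF assms] by (intro exI[of _ "drop n (t (n + k))"]) simp
qed

text \<open>Koenig's step: if the line of every child died out, finite branching would give one
  generation \<open>L\<close> by which all of them have died out, and \<open>v\<close> could not
  survive.\<close>

lemma survives_child:
  assumes "survives c v"
  shows "\<exists>k. survives c (v @ [k])"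
proof (rule ccontr)
  assume "\<not> ?thesis"
  then have "\<forall>k. \<exists>l. \<forall>w. length w = l \<longrightarrow> v @ [k] @ w \<notin> gw_tree c"
    by (auto simp: survives_def)
  then obtain l where l: "\<And>k w. length w = l k \<Longrightarrow> v @ [k] @ w \<notin> gw_tree c" by metis
  define L where "L = Max (l ` {..<c v})"
  obtain w where w: "length w = Suc L" "v @ w \<in> gw_tree c"
    using assms by (auto simp: survives_def)
  then obtain k w' where kw: "w = k # w'" by (cases w) auto
  have k: "k < c v" using w(2) kw unfolding gw_tree_iff
    by (auto dest: spec[of _ "length v"])
  then have "l k \<le> L" unfolding L_def by (intro Max_ge) auto
  moreover have "take (length v + Suc (l k)) (v @ w) \<in> gw_tree c"
    using w(2) by (rule take_in_gw_tree)
  then have "v @ [k] @ take (l k) w' \<in> gw_tree c" by (simp add: kw)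
  ultimately show False using l[of "take (l k) w'" k] w(1) kw by simp
qed

lemma survives_imp_ray:
  assumes "survives c v"
  shows "\<exists>t\<in>rays c. t (length v) = v"
proof -
  \<comment> \<open>The greedy path starts at \<open>v\<close> and not at the root. Since
    \<open>s i\<close> has length \<open>length v + i\<close>, its prefix of length \<open>i\<close>
    exists for every \<open>i\<close>; these prefixes form the ray, running through the ancestors of
    \<open>v\<close> first.\<close>
  define s where "s = rec_nat v (\<lambda>_ w. w @ [SOME k. survives c (w @ [k])])"
  have s0: "s 0 = v" and sS: "\<And>i. \<exists>k. s (Suc i) = s i @ [k]" by (auto simp: s_def)
  have surv: "survives c (s i)" for i
  proof (induction i)
    case 0 then show ?case using assms s0 by simp
  next
    case (Suc i)
    then show ?case using someI_ex[OF survives_child[OF Suc]] by (simp add: s_def)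
  qed
  have len: "length (s i) = length v + i" for i
  proof (induction i)
    case (Suc i) then show ?case using sS[of i] by auto
  qed (simp add: s0)
  have pre: "take (length v) (s i) = v" for i
  proof (induction i)
    case (Suc i) then show ?case using sS[of i] len[of i] by auto
  qed (simp add: s0)
  define t where "t i = take i (s i)" for i
  have "s i \<in> gw_tree c" for i using surv[of i] by (auto simp: survives_def dest: spec[of _ 0])
  then have tree: "t i \<in> gw_tree c" for i unfolding t_def by (rule take_in_gw_tree)
  have step: "\<exists>k. t (Suc i) = t i @ [k]" for i
  proof -
    have "take i (s (Suc i)) = take i (s i)" using sS[of i] len[of i] by auto
    moreover have "take (Suc i) (s (Suc i)) = take i (s (Suc i)) @ [s (Suc i) ! i]"
      using len[of "Suc i"] by (intro take_Suc_conv_app_nth) simp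
    ultimately show ?thesis by (simp add: t_def)
  qed
  have "t \<in> rays c" using tree step by (auto simp: rays_def t_def)
  then show ?thesis using pre by (auto simp: t_def intro!: bexI[of _ t])
qed

subsection \<open>Marks on paths\<close>

text \<open>The supremum runs over all finite paths, including those without infinite continuation.
  It thus dominates the sums along rays while remaining a countable supremum.\<close>

definition path_tail :: "(nat list \<Rightarrow> nat) \<Rightarrow> (nat list \<Rightarrow> real) \<Rightarrow> nat \<Rightarrow> ennreal" where
  "path_tail c x n = (SUP v\<in>gw_tree c. \<Sum>j\<in>{n<..length v}. ennreal (x (take j v)))"

definition path_count :: "(nat list \<Rightarrow> nat) \<Rightarrow> (nat list \<Rightarrow> real) \<Rightarrow> nat \<Rightarrow> real \<Rightarrow> ennreal" where
  "path_count c x n u = (SUP v\<in>gw_tree c. \<Sum>j\<in>{n<..length v}. indicator {..<x (take j v)} u)"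

text \<open>Layer-cake formula for each term; afterwards the supremum over paths moves inside the
  integral, which can only increase the value.\<close>

lemma path_tail_le_nn_integral_path_count:
  "path_tail c x n \<le> (\<integral>\<^sup>+u\<in>{0<..}. path_count c x n u \<partial>lborel)"
  unfolding path_tail_def
proof (rule SUP_least)
  fix v assume v: "v \<in> gw_tree c"
  have "ennreal a = (\<integral>\<^sup>+u\<in>{0<..}. indicator {..<a} u \<partial>lborel)" for a :: real
  proof -
    have "(\<integral>\<^sup>+u\<in>{0<..}. indicator {..<a} u \<partial>lborel) = (\<integral>\<^sup>+u. indicator {0<..<a} u \<partial>lborel)"
      by (intro nn_integral_cong) (auto split: split_indicator)
    also have "\<dots> = ennreal a" by (cases "0 \<le> a") (auto simp: ennreal_neg)
    finally show ?thesis by simp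
  qed
  then have "(\<Sum>j\<in>{n<..length v}. ennreal (x (take j v)))
    = (\<Sum>j\<in>{n<..length v}. \<integral>\<^sup>+u\<in>{0<..}. indicator {..<x (take j v)} u \<partial>lborel)"
    by simp
  also have "\<dots> = (\<integral>\<^sup>+u\<in>{0<..}. (\<Sum>j\<in>{n<..length v}. indicator {..<x (take j v)} u) \<partial>lborel)"
    unfolding sum_distrib_right by (rule nn_integral_sum[symmetric]) simp
  also have "\<dots> \<le> (\<integral>\<^sup>+u\<in>{0<..}. path_count c x n u \<partial>lborel)"
    unfolding path_count_def using v by (intro nn_integral_mono mult_right_mono SUP_upper) auto
  finally show "(\<Sum>j\<in>{n<..length v}. ennreal (x (take j v))) \<le> \<dots>" .
qed

lemma path_tail_antimono: "n \<le> n' \<Longrightarrow> path_tail c x n' \<le> path_tail c x n"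
  unfolding path_tail_def by (intro SUP_mono') (auto intro!: sum_mono2)

text \<open>The marks on one path are distinct vertices, told apart by their lengths, so they are at
  most as many as all marks in the tree.\<close>

lemma path_count_le_marked:
  "path_count c x n u \<le> (\<integral>\<^sup>+v. of_bool (v \<in> gw_tree c \<and> n < length v \<and> u < x v) \<partial>count_space UNIV)"
  unfolding path_count_def
proof (rule SUP_least)
  fix v assume v: "v \<in> gw_tree c"
  let ?f = "\<lambda>v. of_bool (v \<in> gw_tree c \<and> n < length v \<and> u < x v) :: ennreal"
  have inj: "inj_on (\<lambda>j. take j v) {n<..length v}"
    by (rule inj_on_inverseI[of _ length]) simp
  have "(\<Sum>j\<in>{n<..length v}. indicator {..<x (take j v)} u) = (\<Sum>j\<in>{n<..length v}. ?f (take j v))"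
    using v by (intro sum.cong) (auto simp: take_in_gw_tree split: split_indicator)
  also have "\<dots> = (\<Sum>w\<in>(\<lambda>j. take j v) ` {n<..length v}. ?f w)"
    by (simp add: sum.reindex[OF inj])
  also have "\<dots> = (\<integral>\<^sup>+w. ?f w * indicator ((\<lambda>j. take j v) ` {n<..length v}) w \<partial>count_space UNIV)"
    by (subst nn_integral_count_space_indicator[symmetric])
      (auto simp: nn_integral_count_space_finite)
  also have "\<dots> \<le> (\<integral>\<^sup>+w. ?f w \<partial>count_space UNIV)"
    by (intro nn_integral_mono) (auto split: split_indicator)
  finally show "(\<Sum>j\<in>{n<..length v}. indicator {..<x (take j v)} u) \<le> \<dots>" .
qed

text \<open>A pair is indexed by its deeper vertex \<open>v\<close> and the generation
  \<open>i\<close> of the ancestor. Membership of \<open>v\<close> in the tree implies that of the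
  ancestor, and \<open>r < i\<close> keeps the ancestor away from the root.\<close>

definition marked_pairs :: "(nat list \<Rightarrow> nat) \<Rightarrow> (nat list \<Rightarrow> real) \<Rightarrow> nat \<Rightarrow> real \<Rightarrow> ennreal" where
  "marked_pairs c x r u = (\<integral>\<^sup>+v. (\<Sum>i\<in>{r<..<length v}.
      of_bool (v \<in> gw_tree c \<and> u < x v \<and> u < x (take i v))) \<partial>count_space UNIV)"

text \<open>Pairing the first marked generation beyond \<open>r\<close> with each later one loses only one mark.\<close>

lemma path_count_le_marked_pairs:
  "path_count c x n u \<le> of_nat (Suc r) + marked_pairs c x r u"
  unfolding path_count_def
proof (rule SUP_least)
  fix v assume v: "v \<in> gw_tree c"
  define J where "J = {j\<in>{r<..length v}. u < x (take j v)}"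
  define g where "g v = (\<Sum>i\<in>{r<..<length v}.
      of_bool (v \<in> gw_tree c \<and> u < x v \<and> u < x (take i v)) :: ennreal)" for v
  have fin: "finite J" by (simp add: J_def)
  have "(\<Sum>j\<in>{n<..length v}. indicator {..<x (take j v)} u :: ennreal)
      = of_nat (card {j\<in>{n<..length v}. u < x (take j v)})"
    by (simp add: sum_indicator_eq_card indicator_def sum.If_cases Int_def)
  \<comment> \<open>Up to generation \<open>r\<close> every generation is counted as if marked;
    generation 0 never occurs because \<open>n < j\<close>.\<close>
  also have "\<dots> \<le> of_nat (card ({1..r} \<union> J))"
    by (intro of_nat_mono card_mono) (auto simp: J_def)
  also have "\<dots> \<le> of_nat (r + card J)"
    using card_Un_le[of "{1..r}" J] by (intro of_nat_mono) simp
  also have "\<dots> \<le> of_nat (Suc r) + marked_pairs c x r u"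
  proof (cases "J = {}")
    case True
    then show ?thesis by (intro add_increasing2) (auto simp del: of_nat_Suc)
  next
    case False
    define i where "i = Min J"
    have i: "i \<in> J" using False fin by (simp add: i_def)
    have less: "i < j" if "j \<in> J - {i}" for j
      using that fin Min_le[of J j] unfolding i_def by (metis DiffE insertI1 le_neq_implies_less)
    have one: "1 \<le> g (take j v)" if "j \<in> J - {i}" for j
    proof -
      have "of_bool (take j v \<in> gw_tree c \<and> u < x (take j v) \<and> u < x (take i (take j v))) \<le> g (take j v)"
        unfolding g_def using less[OF that] i that
        by (intro member_le_sum) (auto simp: J_def)
      moreover have "take i (take j v) = take i v" using less[OF that] by (simp add: min_def)
      ultimately show ?thesis using i that v by (auto simp: J_def take_in_gw_tree)
    qed
    have inj: "inj_on (\<lambda>j. take j v) (J - {i})"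
      by (rule inj_on_inverseI[of _ length]) (auto simp: J_def)
    have "of_nat (card (J - {i})) \<le> (\<Sum>j\<in>J - {i}. g (take j v))"
      using sum_mono[of "J - {i}" "\<lambda>_. 1" "\<lambda>j. g (take j v)"] one by simp
    also have "\<dots> = (\<Sum>w\<in>(\<lambda>j. take j v) ` (J - {i}). g w)"
      by (simp add: sum.reindex[OF inj])
    also have "\<dots> = (\<integral>\<^sup>+w. g w * indicator ((\<lambda>j. take j v) ` (J - {i})) w \<partial>count_space UNIV)"
      using fin by (subst nn_integral_count_space_indicator[symmetric])
        (auto simp: nn_integral_count_space_finite)
    also have "\<dots> \<le> (\<integral>\<^sup>+w. g w \<partial>count_space UNIV)"
      by (intro nn_integral_mono) (auto split: split_indicator)
    finally have "of_nat (card (J - {i})) \<le> marked_pairs c x r u"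
      by (simp add: g_def marked_pairs_def)
    moreover have "card J = Suc (card (J - {i}))" using i fin by (metis card.remove)
    ultimately show ?thesis by (simp add: add.assoc add_left_mono)
  qed
  finally show "(\<Sum>j\<in>{n<..length v}. indicator {..<x (take j v)} u) \<le> \<dots>" .
qed

subsection \<open>First moments over the tree\<close>

text \<open>Distributivity over an arbitrary alphabet, by splitting off the head and Tonelli for
  counting measure. With \<open>q k\<close> the probability of more than \<open>k\<close> children
  it gives the mean size of generation \<open>n\<close>.\<close>

lemma nn_integral_prod_list_length:
  fixes q :: "'b \<Rightarrow> ennreal"
  shows "(\<integral>\<^sup>+v. (\<Prod>k\<leftarrow>v. q k) \<partial>count_space {v. length v = n}) = (\<integral>\<^sup>+k. q k \<partial>count_space UNIV) ^ n"
proof (induction n)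
  case 0
  show ?case by (simp add: nn_integral_count_space_finite)
next
  case (Suc n)
  have bij: "bij_betw (\<lambda>(k, v). k # v) (UNIV \<times> {v. length v = n}) {v :: 'b list. length v = Suc n}"
    by (rule bij_betw_byWitness[where f' = "\<lambda>v. (hd v, tl v)"]) (auto simp: length_Suc_conv)
  have "(\<integral>\<^sup>+v. (\<Prod>k\<leftarrow>v. q k) \<partial>count_space {v. length v = Suc n})
      = (\<integral>\<^sup>+(k, v). q k * (\<Prod>k\<leftarrow>v. q k) \<partial>count_space (UNIV \<times> {v. length v = n}))"
    by (subst nn_integral_bij_count_space[OF bij, symmetric]) (auto intro!: nn_integral_cong)
  also have "\<dots> = (\<integral>\<^sup>+k. \<integral>\<^sup>+v. q k * (\<Prod>k\<leftarrow>v. q k) * indicator {v. length v = n} v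
      \<partial>count_space UNIV \<partial>count_space UNIV)"
    by (subst nn_integral_count_space_indicator, simp, subst nn_integral_fst_count_space[symmetric])
      (auto intro!: nn_integral_cong split: split_indicator)
  also have "\<dots> = (\<integral>\<^sup>+k. q k * (\<integral>\<^sup>+v. (\<Prod>k\<leftarrow>v. q k) \<partial>count_space {v. length v = n}) \<partial>count_space UNIV)"
    by (subst (2) nn_integral_count_space_indicator)
      (auto simp: nn_integral_cmult[symmetric] mult.assoc intro!: nn_integral_cong)
  also have "\<dots> = (\<integral>\<^sup>+k. q k \<partial>count_space UNIV) ^ Suc n"
    by (simp add: Suc nn_integral_multc)
  finally show ?case .
qed

lemma nn_integral_offspring:
  assumes "offspring_mean Z > 1"
  shows "(\<integral>\<^sup>+k. emeasure (measure_pmf Z) {k<..} \<partial>count_space UNIV) = ennreal (offspring_mean Z)"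
proof -
  \<comment> \<open>A non-integrable function has Bochner integral 0 by default, so a mean above 1
    already forces integrability.\<close>
  have int: "integrable (measure_pmf Z) real"
    using assms not_integrable_integral_eq[of "measure_pmf Z" real]
    by (auto simp: offspring_mean_def)
  have "(\<integral>\<^sup>+k. emeasure (measure_pmf Z) {k<..} \<partial>count_space UNIV)
      = (\<integral>\<^sup>+n. of_nat n \<partial>measure_pmf Z)"
    by (subst nn_integral_nat_function) (auto simp: nn_integral_count_space_nat greaterThan_def)
  also have "\<dots> = ennreal (offspring_mean Z)"
    unfolding offspring_mean_def using nn_integral_eq_integral[OF int]
    by (simp add: ennreal_of_nat_eq_real_of_nat)
  finally show ?thesis .
qed

section \<open>Probabilities of tree membership and of marks\<close>

context discounted_brw
begin

lemma N_measurable [measurable]: "N v \<in> measurable M (count_space UNIV)"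
  using offspring_indep by (auto simp: indep_vars_def)

lemma increment_measurable: "v \<noteq> [] \<Longrightarrow> \<eta> v \<in> borel_measurable M"
  using increments_indep by (auto simp: indep_vars_def)

lemma sets_increment_law [simp, measurable_cong]: "sets L = sets borel"
  using increments_law[of "[0]"] by (metis list.distinct(1) sets_distr)

lemma space_increment_law [simp]: "space L = UNIV"
  using sets_eq_imp_space_eq[OF sets_increment_law] by simp

abbreviation tree :: "'a \<Rightarrow> nat list set" where
  "tree \<omega> \<equiv> gw_tree (\<lambda>v. N v \<omega>)"

lemma tree_measurable [measurable]: "Measurable.pred M (\<lambda>\<omega>. v \<in> tree \<omega>)"
  unfolding gw_tree_iff by measurable

text \<open>The conditions in \<open>gw_tree_iff\<close> concern distinct labels, so independence of
  the offspring numbers gives a product.\<close>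

lemma emeasure_in_tree:
  "emeasure M {\<omega>\<in>space M. v \<in> tree \<omega>} = (\<Prod>k\<leftarrow>v. emeasure (measure_pmf Z) {k<..})"
proof (cases "v = []")
  case True
  then show ?thesis by (simp add: gw_tree.root emeasure_space_1)
next
  case False
  define J where "J = (\<lambda>j. take j v) ` {..<length v}"
  have inj: "inj_on (\<lambda>j. take j v) {..<length v}"
    by (rule inj_on_inverseI[of _ length]) simp
  have law: "prob (N w -` A \<inter> space M) = measure (measure_pmf Z) A" for w A
    unfolding offspring_law[of w, symmetric] by (rule measure_distr[symmetric]) simp_all
  have "{\<omega>\<in>space M. v \<in> tree \<omega>} = (\<Inter>w\<in>J. N w -` {v ! length w<..} \<inter> space M)"
    using False by (auto simp: gw_tree_iff J_def)
  also have "prob \<dots> = (\<Prod>w\<in>J. prob (N w -` {v ! length w<..} \<inter> space M))"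
    using False by (intro indep_varsD[OF offspring_indep]) (auto simp: J_def)
  also have "\<dots> = (\<Prod>w\<in>J. measure (measure_pmf Z) {v ! length w<..})"
    by (simp add: law)
  also have "\<dots> = (\<Prod>j<length v. measure (measure_pmf Z) {v ! j<..})"
    unfolding J_def by (simp add: prod.reindex[OF inj])
  finally have "emeasure M {\<omega>\<in>space M. v \<in> tree \<omega>}
      = (\<Prod>j<length v. emeasure (measure_pmf Z) {v ! j<..})"
    by (simp add: emeasure_eq_measure measure_pmf.emeasure_eq_measure prod_ennreal)
  then show ?thesis
    by (simp add: prod.list_conv_set_nth atLeast0LessThan)
qed

text \<open>Many-to-one formula: sorted by generation, the weights depend only on \<open>j\<close>,
  and generation \<open>j\<close> has mean size \<open>m ^ j\<close>.\<close>

lemma nn_integral_tree_length: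
  fixes F :: "nat \<Rightarrow> ennreal"
  assumes "offspring_mean Z > 1"
  shows "(\<integral>\<^sup>+v. emeasure M {\<omega>\<in>space M. v \<in> tree \<omega>} * F (length v) \<partial>count_space UNIV)
    = (\<Sum>j. ennreal (offspring_mean Z ^ j) * F j)"
proof -
  let ?T = "\<lambda>v. emeasure M {\<omega>\<in>space M. v \<in> tree \<omega>}"
  have "?T v * F (length v) = (\<Sum>j. ?T v * F j * indicator {v. length v = j} v)" for v
    by (subst suminf_finite[of "{length v}"]) (auto split: split_indicator)
  then have "(\<integral>\<^sup>+v. ?T v * F (length v) \<partial>count_space UNIV)
      = (\<integral>\<^sup>+v. (\<Sum>j. ?T v * F j * indicator {v. length v = j} v) \<partial>count_space UNIV)"
    by simp
  also have "\<dots> = (\<Sum>j. \<integral>\<^sup>+v. ?T v * F j * indicator {v. length v = j} v \<partial>count_space UNIV)"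
    by (rule nn_integral_suminf) simp
  also have "\<dots> = (\<Sum>j. \<integral>\<^sup>+v. ?T v * F j \<partial>count_space {v. length v = j})"
    by (subst (2) nn_integral_count_space_indicator) auto
  also have "\<dots> = (\<Sum>j. ennreal (offspring_mean Z ^ j) * F j)"
    using assms by (simp add: nn_integral_multc emeasure_in_tree nn_integral_prod_list_length
        nn_integral_offspring ennreal_power)
  finally show ?thesis .
qed

text \<open>Joins both kinds of independence: tree against increments, and increments among
  themselves. Two labels are what the pair count needs; the single count takes a trivial condition
  on the second.\<close>

lemma prob_tree_increments:
  assumes "v \<noteq> []" "w \<noteq> []" "v \<noteq> w" and [measurable]: "A \<in> sets borel" "B \<in> sets borel"
  shows "prob {\<omega>\<in>space M. x \<in> tree \<omega> \<and> \<eta> v \<omega> \<in> A \<and> \<eta> w \<omega> \<in> B}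
    = prob {\<omega>\<in>space M. x \<in> tree \<omega>} * measure L A * measure L B"
proof -
  let ?P = "Pi\<^sub>M UNIV (\<lambda>_. count_space UNIV) :: (nat list \<Rightarrow> real) measure"
  let ?Q = "Pi\<^sub>M {v. v \<noteq> []} (\<lambda>_. borel) :: (nat list \<Rightarrow> real) measure"
  \<comment> \<open>\<^const>\<open>indep_var\<close> wants both variables of the same type, so in \<open>tree_indep_increments\<close> the
    offspring numbers are coerced to reals.\<close>
  let ?F = "\<lambda>\<omega> w. real ((\<lambda>v\<in>UNIV. N v \<omega>) w)"
  let ?X = "{c\<in>space ?P. x \<in> gw_tree (\<lambda>v. nat \<lfloor>c v\<rfloor>)}"
  let ?Y = "{y\<in>space ?Q. y v \<in> A \<and> y w \<in> B}"
  have [measurable]: "(\<lambda>y. y v) \<in> borel_measurable ?Q" "(\<lambda>y. y w) \<in> borel_measurable ?Q"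
    using assms by (auto intro!: measurable_component_singleton)
  have [measurable]: "(\<lambda>c. nat \<lfloor>c v\<rfloor>) \<in> measurable ?P (count_space UNIV)" for v
    by (rule measurable_compose[OF measurable_component_singleton]) auto
  have X: "?X \<in> sets ?P" unfolding gw_tree_iff by measurable
  have Y: "?Y \<in> sets ?Q" by measurable
  have P: "?F \<omega> \<in> space ?P" and Q: "(\<lambda>v\<in>{v. v \<noteq> []}. \<eta> v \<omega>) \<in> space ?Q" for \<omega>
    by (simp_all add: space_PiM)
  have X_iff: "?F \<omega> \<in> ?X \<longleftrightarrow> x \<in> tree \<omega>" for \<omega>
    by (simp add: space_PiM)
  have Y_iff: "(\<lambda>v\<in>{v. v \<noteq> []}. \<eta> v \<omega>) \<in> ?Y \<longleftrightarrow> \<eta> v \<omega> \<in> A \<and> \<eta> w \<omega> \<in> B" for \<omega>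
    by (simp only: mem_Collect_eq Q restrict_apply assms(1,2) simp_thms if_True)
  have law: "prob (\<eta> v -` A \<inter> space M) = measure L A"
    if "v \<noteq> []" "A \<in> sets borel" for v A
    unfolding increments_law[OF that(1), symmetric]
    using that by (intro measure_distr[symmetric] increment_measurable) auto
  have "prob {\<omega>\<in>space M. x \<in> tree \<omega> \<and> \<eta> v \<omega> \<in> A \<and> \<eta> w \<omega> \<in> B}
    = prob ((\<lambda>\<omega>. (?F \<omega>, \<lambda>v\<in>{v. v \<noteq> []}. \<eta> v \<omega>)) -` (?X \<times> ?Y) \<inter> space M)"
    by (rule arg_cong[of _ _ prob], rule set_eqI, unfold Int_iff vimage_eq mem_Times_iff fst_conv snd_conv X_iff Y_iff) blast
  also have "\<dots> = prob ((\<lambda>\<omega>. ?F \<omega>) -` ?X \<inter> space M)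
      * prob ((\<lambda>\<omega>. \<lambda>v\<in>{v. v \<noteq> []}. \<eta> v \<omega>) -` ?Y \<inter> space M)"
    by (rule indep_varD[OF tree_indep_increments X Y])
  also have "(\<lambda>\<omega>. ?F \<omega>) -` ?X \<inter> space M = {\<omega>\<in>space M. x \<in> tree \<omega>}"
    by (rule set_eqI, unfold Int_iff vimage_eq X_iff) blast
  \<comment> \<open>Because \<open>v\<close> and \<open>w\<close> differ, the two conditions fit
    into one family indexed by \<open>{v, w}\<close>, the form that independence of the increments
    expects.\<close>
  also have "(\<lambda>\<omega>. \<lambda>v\<in>{v. v \<noteq> []}. \<eta> v \<omega>) -` ?Y \<inter> space M
      = (\<Inter>z\<in>{v, w}. \<eta> z -` (if z = v then A else B) \<inter> space M)"
    by (rule set_eqI, unfold Int_iff vimage_eq Y_iff) (use assms(3) in auto)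

  also have "prob \<dots> = (\<Prod>z\<in>{v, w}. prob (\<eta> z -` (if z = v then A else B) \<inter> space M))"
    using assms by (intro indep_varsD[OF increments_indep]) auto
  also have "\<dots> = measure L A * measure L B"
    using assms by (simp add: law)
  finally show ?thesis by (simp add: mult.assoc)
qed

text \<open>The case distinction is needed because nothing is assumed about \<open>\<eta> []\<close>, not even measurability.\<close>

definition abs_term :: "real \<Rightarrow> 'a \<Rightarrow> nat list \<Rightarrow> real" where
  "abs_term H \<omega> v =
    (if v = [] then 0 else offspring_mean Z powr (- (real (length v) * H)) * \<bar>\<eta> v \<omega>\<bar>)"

text \<open>The chance that a vertex of generation \<open>j \<ge> 1\<close> is marked, given that it
  exists. At \<open>j = 0\<close> the value is only formal: the root has weight 0.\<close>

definition mark_prob :: "real \<Rightarrow> real \<Rightarrow> nat \<Rightarrow> ennreal" where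
  "mark_prob H u j = emeasure L {y. u < offspring_mean Z powr (- (real j * H)) * \<bar>y\<bar>}"

lemma abs_term_measurable [measurable]: "(\<lambda>\<omega>. abs_term H \<omega> v) \<in> borel_measurable M"
  unfolding abs_term_def using increment_measurable[of v] by (cases "v = []") simp_all

lemma prob_space_increment_law: "prob_space L"
  using prob_space_distr[OF increment_measurable[of "[0]"]] increments_law[of "[0]"] by simp

lemma emeasure_tree_marked_pair:
  assumes "0 < i" "i < length v"
  shows "emeasure M {\<omega>\<in>space M. v \<in> tree \<omega> \<and> u < abs_term H \<omega> v \<and> u < abs_term H \<omega> (take i v)}
    = emeasure M {\<omega>\<in>space M. v \<in> tree \<omega>} * (mark_prob H u (length v) * mark_prob H u i)"
proof -
  interpret L: prob_space L by (rule prob_space_increment_law)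
  let ?A = "\<lambda>j :: nat. {y :: real. u < offspring_mean Z powr (- (real j * H)) * \<bar>y\<bar>}"
  have len: "length (take i v) = i" using assms by simp
  have ne: "v \<noteq> []" "take i v \<noteq> []" using assms by auto
  have neq: "v \<noteq> take i v" using len assms(2) by (metis less_irrefl)
  from ne have eq: "{\<omega>\<in>space M. v \<in> tree \<omega> \<and> u < abs_term H \<omega> v \<and> u < abs_term H \<omega> (take i v)}
    = {\<omega>\<in>space M. v \<in> tree \<omega> \<and> \<eta> v \<omega> \<in> ?A (length v) \<and> \<eta> (take i v) \<omega> \<in> ?A i}"
    using assms by (auto simp: abs_term_def)
  have "prob {\<omega>\<in>space M. v \<in> tree \<omega> \<and> \<eta> v \<omega> \<in> ?A (length v) \<and> \<eta> (take i v) \<omega> \<in> ?A i}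
    = prob {\<omega>\<in>space M. v \<in> tree \<omega>} * measure L (?A (length v)) * measure L (?A i)"
    by (rule prob_tree_increments[OF ne neq]) measurable
  then show ?thesis
    unfolding eq emeasure_eq_measure L.emeasure_eq_measure mark_prob_def
    by (simp only: ennreal_mult measure_nonneg mult_nonneg_nonneg mult.assoc)
qed

lemma emeasure_tree_marked:
  assumes "v \<noteq> []"
  shows "emeasure M {\<omega>\<in>space M. v \<in> tree \<omega> \<and> u < abs_term H \<omega> v}
    = emeasure M {\<omega>\<in>space M. v \<in> tree \<omega>} * mark_prob H u (length v)"
proof -
  interpret L: prob_space L by (rule prob_space_increment_law)
  let ?A = "{y :: real. u < offspring_mean Z powr (- (real (length v) * H)) * \<bar>y\<bar>}"
  \<comment> \<open>\<open>v @ v\<close> is a dummy second label: it is neither the root nor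
    \<open>v\<close>, and its condition is void.\<close>
  have "{\<omega>\<in>space M. v \<in> tree \<omega> \<and> u < abs_term H \<omega> v}
    = {\<omega>\<in>space M. v \<in> tree \<omega> \<and> \<eta> v \<omega> \<in> ?A \<and> \<eta> (v @ v) \<omega> \<in> UNIV}"
    using assms by (auto simp: abs_term_def)
  also have "prob \<dots> = prob {\<omega>\<in>space M. v \<in> tree \<omega>} * measure L ?A * measure L UNIV"
    using assms by (intro prob_tree_increments) (simp_all, measurable)
  also have "measure L UNIV = 1" using L.prob_space by simp
  finally show ?thesis
    unfolding emeasure_eq_measure L.emeasure_eq_measure mark_prob_def
    by (simp only: ennreal_mult measure_nonneg mult_1_right)
qed

lemma nn_integral_of_bool:
  assumes "Measurable.pred M P"
  shows "(\<integral>\<^sup>+\<omega>. of_bool (P \<omega>) \<partial>M) = emeasure M {\<omega>\<in>space M. P \<omega>}"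
proof -
  have "(\<integral>\<^sup>+\<omega>. of_bool (P \<omega>) \<partial>M) = (\<integral>\<^sup>+\<omega>. indicator {\<omega>\<in>space M. P \<omega>} \<omega> \<partial>M)"
    by (intro nn_integral_cong) (auto split: split_indicator)
  then show ?thesis using assms by simp
qed

lemma nn_integral_marked:
  assumes "offspring_mean Z > 1"
  shows "(\<integral>\<^sup>+\<omega>. \<integral>\<^sup>+v. of_bool (v \<in> tree \<omega> \<and> n < length v \<and> u < abs_term H \<omega> v) \<partial>count_space UNIV \<partial>M)
    = (\<Sum>j. ennreal (offspring_mean Z ^ j) * (of_bool (n < j) * mark_prob H u j))"
proof -
  have "(\<integral>\<^sup>+\<omega>. of_bool (v \<in> tree \<omega> \<and> n < length v \<and> u < abs_term H \<omega> v) \<partial>M)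
    = emeasure M {\<omega>\<in>space M. v \<in> tree \<omega>} * (of_bool (n < length v) * mark_prob H u (length v))" for v
  proof (cases "n < length v")
    case True
    then have "v \<noteq> []" by auto
    then show ?thesis using True by (simp add: nn_integral_of_bool emeasure_tree_marked)
  qed simp
  then show ?thesis
    by (subst nn_integral_count_space_nn_integral)
      (simp_all add: nn_integral_tree_length[OF assms, of "\<lambda>l. of_bool (n < l) * mark_prob H u l"])
qed

text \<open>Only the deeper vertex contributes a factor \<open>m ^ j\<close>: the ancestor is
  determined by it and by \<open>i\<close>.\<close>

lemma nn_integral_marked_pairs:
  assumes "offspring_mean Z > 1"
  shows "(\<integral>\<^sup>+\<omega>. marked_pairs (\<lambda>v. N v \<omega>) (abs_term H \<omega>) r u \<partial>M)
    = (\<Sum>j. ennreal (offspring_mean Z ^ j) * (\<Sum>i\<in>{r<..<j}. mark_prob H u j * mark_prob H u i))"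
proof -
  have "(\<integral>\<^sup>+\<omega>. (\<Sum>i\<in>{r<..<length v}. of_bool (v \<in> tree \<omega> \<and> u < abs_term H \<omega> v
        \<and> u < abs_term H \<omega> (take i v))) \<partial>M)
    = emeasure M {\<omega>\<in>space M. v \<in> tree \<omega>}
      * (\<Sum>i\<in>{r<..<length v}. mark_prob H u (length v) * mark_prob H u i)" for v
    by (subst nn_integral_sum) (simp_all add: nn_integral_of_bool emeasure_tree_marked_pair sum_distrib_left)
  then show ?thesis unfolding marked_pairs_def
    by (subst nn_integral_count_space_nn_integral) (simp_all add: nn_integral_tree_length[OF assms, of "\<lambda>l. (\<Sum>i\<in>{r<..<l}. mark_prob H u l * mark_prob H u i)"])
qed

end

subsection \<open>Moment bounds for the number of marks\<close>

text \<open>A geometric sum is comparable to its last term, and the last term counted is below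
  \<open>X\<close>.\<close>

lemma sum_truncated_geometric_le:
  fixes m X :: real
  assumes "1 < m" "0 \<le> X"
  shows "(\<Sum>j<k. m ^ j * of_bool (m ^ j < X)) \<le> m / (m - 1) * X"
proof -
  \<comment> \<open>The minimum strengthens the induction: \<open>m ^ k\<close> bounds the sum while
    terms still count, \<open>m * X\<close> after they have stopped.\<close>
  have "(\<Sum>j<k. m ^ j * of_bool (m ^ j < X)) \<le> min (m ^ k) (m * X) / (m - 1)"
  proof (induction k)
    case 0
    then show ?case using assms by simp
  next
    case (Suc k)
    show ?case
    proof (cases "m ^ k < X")
      case True
      have "min (m ^ k) (m * X) / (m - 1) \<le> m ^ k / (m - 1)"
        using assms by (intro divide_right_mono) auto
      with Suc have "(\<Sum>j<k. m ^ j * of_bool (m ^ j < X)) \<le> m ^ k / (m - 1)" by linarith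
      then have "(\<Sum>j<Suc k. m ^ j * of_bool (m ^ j < X)) \<le> m ^ k / (m - 1) + m ^ k"
        unfolding sum.lessThan_Suc using True by simp
      also have "\<dots> = m ^ Suc k / (m - 1)" using assms by (simp add: field_simps)
      also have "m ^ Suc k = min (m ^ Suc k) (m * X)" using True assms by (simp add: min_def)
      finally show ?thesis .
    next
      case False
      have "m ^ k \<le> m ^ Suc k" using assms by simp
      then have "min (m ^ k) (m * X) / (m - 1) \<le> min (m ^ Suc k) (m * X) / (m - 1)"
        using assms by (intro divide_right_mono min.mono) auto
      then show ?thesis using Suc False by simp
    qed
  qed
  also have "\<dots> \<le> m * X / (m - 1)" using assms by (intro divide_right_mono) auto
  finally show ?thesis by simp
qed

lemma powr_less_cancel_base_iff:
  fixes a b e :: real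
  assumes "0 < e" "0 \<le> a" "0 \<le> b"
  shows "a powr e < b powr e \<longleftrightarrow> a < b"
  using assms powr_less_mono2[of e a b] powr_mono2[of e b a] by linarith

text \<open>For fixed \<open>y\<close> the mark condition in generation \<open>j\<close> reads
  \<open>m ^ j < X\<close>, with \<open>X\<close> a multiple of the power \<open>1 / H\<close> of
  the absolute value of \<open>y\<close>. This is how the moment of order \<open>1 / H\<close>
  enters.\<close>

lemma suminf_weighted_mark_le:
  fixes m H u y :: real
  assumes "1 < m" "0 < H" "0 < u"
  shows "(\<Sum>j. ennreal (m ^ j) * of_bool (u < m powr (- (real j * H)) * \<bar>y\<bar>))
    \<le> ennreal (m / (m - 1) * u powr (- 1 / H) * \<bar>y\<bar> powr (1 / H))"
proof -
  define X where "X = (\<bar>y\<bar> / u) powr (1 / H)"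
  have iff: "u < m powr (- (real j * H)) * \<bar>y\<bar> \<longleftrightarrow> m ^ j < X" for j
  proof -
    have "u < m powr (- (real j * H)) * \<bar>y\<bar> \<longleftrightarrow> m powr (real j * H) < \<bar>y\<bar> / u"
      using assms by (simp add: powr_minus field_simps)
    also have "m powr (real j * H) = (m ^ j) powr H"
      using assms by (simp add: powr_powr[symmetric] powr_realpow)
    also have "(m ^ j) powr H < \<bar>y\<bar> / u \<longleftrightarrow> ((m ^ j) powr H) powr (1 / H) < X"
      unfolding X_def using assms by (intro powr_less_cancel_base_iff[symmetric]) auto
    also have "((m ^ j) powr H) powr (1 / H) = m ^ j" using assms by (simp add: powr_powr)
    finally show ?thesis .
  qed
  have "(\<Sum>j. ennreal (m ^ j) * of_bool (u < m powr (- (real j * H)) * \<bar>y\<bar>))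
      = (\<Sum>j. ennreal (m ^ j * of_bool (m ^ j < X)))"
    unfolding iff by (intro suminf_cong) simp
  also have "\<dots> \<le> ennreal (m / (m - 1) * X)"
  proof (rule suminf_le_const[OF summableI])
    fix k
    have "(\<Sum>j<k. ennreal (m ^ j * of_bool (m ^ j < X))) = ennreal (\<Sum>j<k. m ^ j * of_bool (m ^ j < X))"
      using assms by (intro sum_ennreal) auto
    also have "\<dots> \<le> ennreal (m / (m - 1) * X)"
      using assms by (intro ennreal_leI sum_truncated_geometric_le) (auto simp: X_def)
    finally show "(\<Sum>j<k. ennreal (m ^ j * of_bool (m ^ j < X))) \<le> \<dots>" .
  qed
  also have "X = u powr (- 1 / H) * \<bar>y\<bar> powr (1 / H)"
    using assms by (simp add: X_def powr_divide powr_minus_divide minus_divide_left[symmetric])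
  finally show ?thesis by (simp add: mult.assoc)
qed

lemma nn_integral_powr_Ioc_less_top:
  fixes a c :: real
  assumes "-1 < a" "0 \<le> c"
  shows "(\<integral>\<^sup>+u\<in>{0<..c}. ennreal (u powr a) \<partial>lborel) < \<infinity>"
proof -
  obtain I where "((\<lambda>u. u powr a) has_integral I) {0<..c}"
    using integrable_on_powr_from_0'[OF assms] by blast
  from nn_integral_has_integral_lebesgue[OF _ this]
  have "(\<integral>\<^sup>+u. ennreal (indicator {0<..c} u * u powr a) \<partial>lborel) = ennreal I" by simp
  moreover have "ennreal (indicator {0<..c} u * u powr a) = ennreal (u powr a) * indicator {0<..c} u" for u
    by (simp split: split_indicator)
  ultimately show ?thesis by simp
qed

lemma nn_integral_powr_atLeast_less_top:
  fixes a c :: real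
  assumes "a < -1" "0 < c"
  shows "(\<integral>\<^sup>+u\<in>{c..}. ennreal (u powr a) \<partial>lborel) < \<infinity>"
proof -
  from nn_integral_has_integral_lebesgue[OF _ has_integral_powr_to_inf[OF assms]]
  have "(\<integral>\<^sup>+u. ennreal (indicator {c..} u * u powr a) \<partial>lborel) < \<infinity>" by simp
  moreover have "ennreal (indicator {c..} u * u powr a) = ennreal (u powr a) * indicator {c..} u" for u
    by (simp split: split_indicator)
  ultimately show ?thesis by simp
qed

lemma suminf_tail_ennreal_tendsto_0:
  fixes f :: "nat \<Rightarrow> ennreal"
  assumes "(\<Sum>j. f j) < \<infinity>"
  shows "(\<lambda>n. \<Sum>j. of_bool (n < j) * f j) \<longlonglongrightarrow> 0"
proof -
  have "(\<lambda>n. \<integral>\<^sup>+j. of_bool (n < j) * f j \<partial>count_space UNIV) \<longlonglongrightarrow> (\<integral>\<^sup>+j. 0 \<partial>(count_space UNIV :: nat measure))"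
  proof (rule nn_integral_dominated_convergence[where w = f])
    show "AE j in count_space UNIV. (\<lambda>n. of_bool (n < j) * f j) \<longlonglongrightarrow> 0"
    proof (rule AE_I2)
      fix j
      have "\<forall>\<^sub>F n in sequentially. of_bool (n < j) * f j = 0"
        using eventually_ge_at_top[of j] by eventually_elim simp
      then show "(\<lambda>n. of_bool (n < j) * f j) \<longlonglongrightarrow> 0" by (rule tendsto_eventually)
    qed
  qed (use assms in \<open>auto simp: nn_integral_count_space_nat of_bool_def\<close>)
  then show ?thesis by (simp add: nn_integral_count_space_nat)
qed

text \<open>Moves a random index set into the function, so that the supremum runs over a fixed
  countable type; 0 is harmless as the least element.\<close>

lemma SUP_if_mem:
  fixes f :: "'b \<Rightarrow> ennreal"
  shows "(SUP v\<in>A. f v) = (SUP v. if v \<in> A then f v else 0)"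
proof (rule antisym)
  show "(SUP v\<in>A. f v) \<le> (SUP v. if v \<in> A then f v else 0)"
  proof (rule SUP_least)
    fix v assume "v \<in> A"
    then show "f v \<le> (SUP v. if v \<in> A then f v else 0)" by (intro SUP_upper2[of v]) auto
  qed
  show "(SUP v. if v \<in> A then f v else 0) \<le> (SUP v\<in>A. f v)"
    by (rule SUP_least) (auto intro: SUP_upper)
qed

section \<open>Expected number of marks at a fixed level\<close>

locale discounted_brw_moment = discounted_brw +
  fixes H :: real
  assumes H: "0 < H" "H < 1" and mean: "offspring_mean Z > 1"
    and moment: "(\<integral>\<^sup>+y. ennreal (\<bar>y\<bar> powr (1 / H)) \<partial>L) < \<infinity>"
begin

abbreviation m :: real where "m \<equiv> offspring_mean Z"

text \<open>The summand 1 secures \<open>C_ge_1\<close>, so that the first moment bound is at least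
  1 for \<open>u < 1\<close> and its logarithm is nonnegative.\<close>

definition C :: real where
  "C = 1 + m / (m - 1) * enn2real (\<integral>\<^sup>+y. ennreal (\<bar>y\<bar> powr (1 / H)) \<partial>L)"

lemma C_ge_1: "1 \<le> C"
  using mean by (simp add: C_def)

lemma suminf_mark_prob_le:
  assumes "0 < u"
  shows "(\<Sum>j. ennreal (m ^ j) * mark_prob H u j) \<le> ennreal (C * u powr (- 1 / H))"
proof -
  let ?A = "\<lambda>j y. of_bool (u < m powr (- (real j * H)) * \<bar>y\<bar>) :: ennreal"
  let ?I = "\<integral>\<^sup>+y. ennreal (\<bar>y\<bar> powr (1 / H)) \<partial>L"
  have "mark_prob H u j = (\<integral>\<^sup>+y. ?A j y \<partial>L)" for j
  proof -
    have "(\<integral>\<^sup>+y. ?A j y \<partial>L) = (\<integral>\<^sup>+y. indicator {y. u < m powr (- (real j * H)) * \<bar>y\<bar>} y \<partial>L)"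
      by (intro nn_integral_cong) (auto split: split_indicator)
    then show ?thesis by (simp add: mark_prob_def)
  qed
  then have "(\<Sum>j. ennreal (m ^ j) * mark_prob H u j) = (\<integral>\<^sup>+y. (\<Sum>j. ennreal (m ^ j) * ?A j y) \<partial>L)"
    by (simp add: nn_integral_cmult[symmetric] nn_integral_suminf)
  also have "\<dots> \<le> (\<integral>\<^sup>+y. ennreal (m / (m - 1) * u powr (- 1 / H) * \<bar>y\<bar> powr (1 / H)) \<partial>L)"
    using mean H assms by (intro nn_integral_mono suminf_weighted_mark_le)
  also have "\<dots> = (\<integral>\<^sup>+y. ennreal (m / (m - 1) * u powr (- 1 / H)) * ennreal (\<bar>y\<bar> powr (1 / H)) \<partial>L)"
    using mean by (intro nn_integral_cong ennreal_mult) auto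
  also have "\<dots> = ennreal (m / (m - 1) * u powr (- 1 / H)) * ?I"
    by (rule nn_integral_cmult) measurable
  also have "?I = ennreal (enn2real ?I)" using moment by simp
  also have "ennreal (m / (m - 1) * u powr (- 1 / H)) * ennreal (enn2real ?I)
    \<le> ennreal (C * u powr (- 1 / H))"
  proof -
    have "a * p * e \<le> (1 + a * e) * p" if "0 \<le> p" for a p e :: real
      using that by (simp add: algebra_simps)
    then show ?thesis
      unfolding C_def using mean by (subst ennreal_mult[symmetric]) (auto intro!: ennreal_leI simp del: ennreal_plus times_divide_eq_left times_divide_eq_right)
  qed
  finally show ?thesis .
qed

text \<open>One term of the series in \<open>suminf_mark_prob_le\<close> is at most the whole sum.
  The resulting geometric decay makes pairs in late generations rare.\<close>

lemma mark_prob_le: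
  assumes "0 < u"
  shows "mark_prob H u j \<le> ennreal (C * u powr (- 1 / H) * (1 / m) ^ j)"
proof -
  let ?f = "\<lambda>j. ennreal (m ^ j) * mark_prob H u j"
  have "?f j \<le> (\<Sum>j. ?f j)" using sum_le_suminf[of ?f "{j}"] by simp
  also have "\<dots> \<le> ennreal (C * u powr (- 1 / H))" by (rule suminf_mark_prob_le[OF assms])
  finally have "ennreal ((1 / m) ^ j) * ?f j \<le> ennreal ((1 / m) ^ j) * ennreal (C * u powr (- 1 / H))"
    by (rule mult_left_mono) simp
  moreover have "ennreal ((1 / m) ^ j) * ?f j = mark_prob H u j"
    using mean by (subst mult.assoc[symmetric], subst ennreal_mult[symmetric]) (auto simp: power_divide)
  ultimately show ?thesis
    using mean C_ge_1 by (subst (asm) ennreal_mult[symmetric]) (auto simp: mult.commute)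
qed

text \<open>The bound is free of \<open>j\<close>, hence factors out of the sum over the generation
  of the deeper vertex.\<close>

lemma sum_mark_prob_tail_le:
  assumes "0 < u"
  shows "(\<Sum>i\<in>{r<..<j}. mark_prob H u i) \<le> ennreal (C * u powr (- 1 / H) * (1 / m) ^ r / (m - 1))"
proof -
  have geom: "(\<Sum>i\<in>{r<..<j}. (1 / m) ^ i) \<le> (1 / m) ^ r / (m - 1)"
  proof -
    \<comment> \<open>Enlarging the range to exactly \<open>j\<close> terms avoids a case
      distinction on \<open>r < j\<close> when shifting the index.\<close>
    have "(\<Sum>i\<in>{r<..<j}. (1 / m) ^ i) \<le> (\<Sum>i\<in>{Suc r..<Suc r + j}. (1 / m) ^ i)"
      using mean by (intro sum_mono2) auto
    also have "\<dots> = (1 / m) ^ Suc r * (\<Sum>i<j. (1 / m) ^ i)"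
      unfolding sum_distrib_left
      by (rule sum.reindex_bij_witness[of _ "\<lambda>i. Suc r + i" "\<lambda>i. i - Suc r"])
        (auto simp flip: power_add power_Suc simp del: power_Suc)
    also have "\<dots> \<le> (1 / m) ^ Suc r * (1 / (1 - 1 / m))"
      using mean by (intro mult_left_mono) (simp_all add: sum_gp_strict divide_right_mono)
    also have "\<dots> = (1 / m) ^ r / (m - 1)" using mean by (simp add: field_simps)
    finally show ?thesis .
  qed
  have "(\<Sum>i\<in>{r<..<j}. mark_prob H u i) \<le> (\<Sum>i\<in>{r<..<j}. ennreal (C * u powr (- 1 / H) * (1 / m) ^ i))"
    by (intro sum_mono mark_prob_le assms)
  also have "\<dots> = ennreal (C * u powr (- 1 / H) * (\<Sum>i\<in>{r<..<j}. (1 / m) ^ i))"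
    using mean C_ge_1 by (subst sum_ennreal) (auto simp: sum_distrib_left)
  also have "\<dots> \<le> ennreal (C * u powr (- 1 / H) * ((1 / m) ^ r / (m - 1)))"
    using geom C_ge_1 by (intro ennreal_leI mult_left_mono) auto
  finally show ?thesis by simp
qed

lemma marked_pairs_measurable [measurable]:
  "(\<lambda>\<omega>. marked_pairs (\<lambda>v. N v \<omega>) (abs_term H \<omega>) r u) \<in> borel_measurable M"
proof -
  interpret sigma_finite_measure "count_space (UNIV :: nat list set)"
    by (rule sigma_finite_measure_count_space_countable) simp
  show ?thesis
    unfolding marked_pairs_def
    by (rule borel_measurable_nn_integral, subst measurable_pair_swap_iff,
        rule measurable_pair_measure_countable1) (simp_all, measurable)
qed

abbreviation pcount :: "nat \<Rightarrow> real \<Rightarrow> 'a \<Rightarrow> ennreal" where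
  "pcount n u \<omega> \<equiv> path_count (\<lambda>v. N v \<omega>) (abs_term H \<omega>) n u"

lemma nn_integral_path_count_le_tail:
  "(\<integral>\<^sup>+\<omega>. pcount n u \<omega> \<partial>M) \<le> (\<Sum>j. of_bool (n < j) * (ennreal (m ^ j) * mark_prob H u j))"
proof -
  have "(\<integral>\<^sup>+\<omega>. pcount n u \<omega> \<partial>M)
    \<le> (\<integral>\<^sup>+\<omega>. \<integral>\<^sup>+v. of_bool (v \<in> tree \<omega> \<and> n < length v \<and> u < abs_term H \<omega> v) \<partial>count_space UNIV \<partial>M)"
    by (intro nn_integral_mono path_count_le_marked)
  also have "\<dots> = (\<Sum>j. of_bool (n < j) * (ennreal (m ^ j) * mark_prob H u j))"
    unfolding nn_integral_marked[OF mean] by (simp add: mult_ac)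
  finally show ?thesis .
qed

text \<open>An integrable majorant for all \<open>n\<close> at once. Below 1 the logarithmic bound
  is relaxed to the power \<open>-1/2\<close>, integrable at 0; from 1 on it is the first moment
  bound, integrable at infinity as \<open>1 / H > 1\<close>.\<close>

definition count_bound :: "real \<Rightarrow> real" where
  "count_bound u = (if u < 1 then (4 / (H * ln m) * C powr (H / 2) + 2 + 1 / (m - 1)) * u powr (- 1 / 2)
    else C * u powr (- 1 / H))"

text \<open>
  For small \<open>u\<close> the first moment is too large. Beyond generation \<open>r \<approx> 2 log\<^sub>m B\<close>, where \<open>B\<close>
  is the first moment bound, two marks on one path are unlikely, so a path carries at most about
  \<open>r + 1\<close> marks.
\<close>

lemma nn_integral_path_count_le:
  assumes "0 < u"
  shows "(\<integral>\<^sup>+\<omega>. pcount n u \<omega> \<partial>M) \<le> ennreal (count_bound u)"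
proof (cases "u < 1")
  case False
  have "(\<integral>\<^sup>+\<omega>. pcount n u \<omega> \<partial>M) \<le> (\<Sum>j. of_bool (n < j) * (ennreal (m ^ j) * mark_prob H u j))"
    by (rule nn_integral_path_count_le_tail)
  also have "\<dots> \<le> (\<Sum>j. ennreal (m ^ j) * mark_prob H u j)"
    by (intro suminf_le) auto
  also have "\<dots> \<le> ennreal (count_bound u)"
    using suminf_mark_prob_le[OF assms] False by (simp add: count_bound_def)
  finally show ?thesis .
next
  case True
  define B where "B = C * u powr (- 1 / H)"
  have "1 \<le> u powr (- 1 / H)" using True assms H by (simp add: powr_mono2 ge_one_powr_ge_zero powr_minus_divide powr_le1)
  then have B: "1 \<le> B" using C_ge_1 unfolding B_def by (metis mult_mono' mult_1 zero_le_one)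
  \<comment> \<open>Chosen so that \<open>m ^ r\<close> absorbs \<open>B\<^sup>2\<close>: the
    expected number of pairs has one factor \<open>B\<close> from the deeper vertex and another from
    its ancestor.\<close>
  define r where "r = nat \<lceil>2 * log m B\<rceil>"
  have log: "0 \<le> log m B" using B mean by simp
  have r_le: "real r \<le> 2 * log m B + 1" using log unfolding r_def by linarith
  have "B\<^sup>2 = m powr (2 * log m B)"
    using B mean by (simp add: powr_powr[symmetric] powr_numeral mult.commute[of 2])
  also have "\<dots> \<le> m powr real r" using mean by (intro powr_mono) (auto simp: r_def real_nat_ceiling_ge simp del: of_nat_nat)
  finally have r: "B\<^sup>2 \<le> m ^ r" using mean by (simp add: powr_realpow)
  have "(\<integral>\<^sup>+\<omega>. marked_pairs (\<lambda>v. N v \<omega>) (abs_term H \<omega>) r u \<partial>M)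
    = (\<Sum>j. ennreal (m ^ j) * mark_prob H u j * (\<Sum>i\<in>{r<..<j}. mark_prob H u i))"
    unfolding nn_integral_marked_pairs[OF mean] by (simp add: sum_distrib_left mult.assoc)
  also have "\<dots> \<le> (\<Sum>j. ennreal (m ^ j) * mark_prob H u j * ennreal (B * (1 / m) ^ r / (m - 1)))"
    unfolding B_def by (intro suminf_le mult_left_mono sum_mark_prob_tail_le[OF assms]) auto
  also have "\<dots> = (\<Sum>j. ennreal (m ^ j) * mark_prob H u j) * ennreal (B * (1 / m) ^ r / (m - 1))"
    by simp
  also have "\<dots> \<le> ennreal B * ennreal (B * (1 / m) ^ r / (m - 1))"
    unfolding B_def by (intro mult_right_mono suminf_mark_prob_le[OF assms]) auto
  also have "\<dots> = ennreal (B\<^sup>2 / m ^ r / (m - 1))"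
    using B mean by (subst ennreal_mult[symmetric]) (auto simp: power2_eq_square power_divide)
  also have "\<dots> \<le> ennreal (1 / (m - 1))"
    using r mean by (intro ennreal_leI divide_right_mono) auto
  finally have pairs: "(\<integral>\<^sup>+\<omega>. marked_pairs (\<lambda>v. N v \<omega>) (abs_term H \<omega>) r u \<partial>M) \<le> ennreal (1 / (m - 1))" .
  have "(\<integral>\<^sup>+\<omega>. pcount n u \<omega> \<partial>M)
    \<le> (\<integral>\<^sup>+\<omega>. of_nat (Suc r) + marked_pairs (\<lambda>v. N v \<omega>) (abs_term H \<omega>) r u \<partial>M)"
    by (intro nn_integral_mono path_count_le_marked_pairs)
  also have "\<dots> = of_nat (Suc r) + (\<integral>\<^sup>+\<omega>. marked_pairs (\<lambda>v. N v \<omega>) (abs_term H \<omega>) r u \<partial>M)"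
    by (subst nn_integral_add) (auto simp: emeasure_space_1)
  also have "\<dots> \<le> ennreal (real (Suc r)) + ennreal (1 / (m - 1))"
    using pairs by (simp add: ennreal_of_nat_eq_real_of_nat add_left_mono del: of_nat_Suc)
  also have "\<dots> = ennreal (real (Suc r) + 1 / (m - 1))" using mean by simp
  also have "\<dots> \<le> ennreal (count_bound u)"
  proof (rule ennreal_leI)
    \<comment> \<open>The exponent \<open>H / 2\<close> turns the factor
      \<open>u powr (- 1 / H)\<close> of \<open>B\<close> into
      \<open>u powr (- 1 / 2)\<close>.\<close>
    have "ln B \<le> B powr (H / 2) / (H / 2)" using B H by (intro ln_powr_bound) auto
    also have "B powr (H / 2) = C powr (H / 2) * u powr (- 1 / 2)"
      using C_ge_1 H by (simp add: B_def powr_mult powr_powr)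
    finally have "2 * log m B \<le> 4 / (H * ln m) * C powr (H / 2) * u powr (- 1 / 2)"
      using mean H by (simp add: log_def field_simps)
    moreover have "1 \<le> u powr (- 1 / 2)" using True assms by (simp add: powr_minus_divide powr_le1)
    then have "(2 + 1 / (m - 1)) * 1 \<le> (2 + 1 / (m - 1)) * u powr (- 1 / 2)"
      using mean by (intro mult_left_mono) auto
    ultimately show "real (Suc r) + 1 / (m - 1) \<le> count_bound u"
      using r_le True by (simp add: count_bound_def distrib_right)
  qed
  finally show ?thesis .
qed

lemma nn_integral_count_bound: "(\<integral>\<^sup>+u\<in>{0<..}. ennreal (count_bound u) \<partial>lborel) < \<infinity>"
proof -
  define D where "D = 4 / (H * ln m) * C powr (H / 2) + 2 + 1 / (m - 1)"
  have cb: "count_bound u = (if u < 1 then D * u powr (- 1 / 2) else C * u powr (- 1 / H))" for u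
    unfolding count_bound_def D_def ..
  have D: "0 \<le> D" using mean H C_ge_1 by (simp add: D_def)
  have "(\<integral>\<^sup>+u\<in>{0<..}. ennreal (count_bound u) \<partial>lborel)
    \<le> (\<integral>\<^sup>+u. ennreal D * (ennreal (u powr (- 1 / 2)) * indicator {0<..1} u)
        + ennreal C * (ennreal (u powr (- 1 / H)) * indicator {1..} u) \<partial>lborel)"
    using D C_ge_1 by (intro nn_integral_mono)
      (auto simp: cb ennreal_mult split: split_indicator)
  also have "\<dots> = ennreal D * (\<integral>\<^sup>+u\<in>{0<..1}. ennreal (u powr (- 1 / 2)) \<partial>lborel)
      + ennreal C * (\<integral>\<^sup>+u\<in>{1..}. ennreal (u powr (- 1 / H)) \<partial>lborel)"
    by (subst nn_integral_add) (auto simp: nn_integral_cmult)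
  also have "\<dots> < \<infinity>"
    using nn_integral_powr_Ioc_less_top[of "- 1 / 2" 1] nn_integral_powr_atLeast_less_top[of "- 1 / H" 1] H
    by (auto simp: ennreal_mult_less_top)
  finally show ?thesis .
qed

section \<open>From counts of marks to expected tails of path sums\<close>

lemma path_count_measurable [measurable]:
  "(\<lambda>(\<omega>, u). pcount n u \<omega>) \<in> borel_measurable (M \<Otimes>\<^sub>M borel)"
proof -
  have "pcount n u \<omega> = (SUP v. if v \<in> tree \<omega>
      then \<Sum>j\<in>{n<..length v}. of_bool (u < abs_term H \<omega> (take j v)) else 0)" for u \<omega>
    unfolding path_count_def by (subst SUP_if_mem) (simp only: indicator_def of_bool_def lessThan_iff)
  then show ?thesis by (simp only:) measurable
qed

abbreviation ptail :: "nat \<Rightarrow> 'a \<Rightarrow> ennreal" where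
  "ptail n \<omega> \<equiv> path_tail (\<lambda>v. N v \<omega>) (abs_term H \<omega>) n"

lemma path_tail_measurable [measurable]: "ptail n \<in> borel_measurable M"
proof -
  have "ptail n \<omega> = (SUP v. if v \<in> tree \<omega>
      then \<Sum>j\<in>{n<..length v}. ennreal (abs_term H \<omega> (take j v)) else 0)" for \<omega>
    unfolding path_tail_def by (rule SUP_if_mem)
  then show ?thesis by (simp only:) measurable
qed

lemma nn_integral_path_tail_le:
  "(\<integral>\<^sup>+\<omega>. ptail n \<omega> \<partial>M) \<le> (\<integral>\<^sup>+u. (\<integral>\<^sup>+\<omega>. pcount n u \<omega> \<partial>M) * indicator {0<..} u \<partial>lborel)"
proof -
  interpret pair_sigma_finite M lborel ..
  have "(\<integral>\<^sup>+\<omega>. ptail n \<omega> \<partial>M) \<le> (\<integral>\<^sup>+\<omega>. \<integral>\<^sup>+u. pcount n u \<omega> * indicator {0<..} u \<partial>lborel \<partial>M)"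
    by (intro nn_integral_mono path_tail_le_nn_integral_path_count)
  also have "\<dots> = (\<integral>\<^sup>+u. \<integral>\<^sup>+\<omega>. pcount n u \<omega> * indicator {0<..} u \<partial>M \<partial>lborel)"
    by (rule Fubini'[symmetric]) measurable
  also have "\<dots> = (\<integral>\<^sup>+u. (\<integral>\<^sup>+\<omega>. pcount n u \<omega> \<partial>M) * indicator {0<..} u \<partial>lborel)"
    by (intro nn_integral_cong nn_integral_multc) measurable
  finally show ?thesis .
qed

lemma nn_integral_path_tail_less_top: "(\<integral>\<^sup>+\<omega>. ptail n \<omega> \<partial>M) < \<infinity>"
proof -
  have "(\<integral>\<^sup>+\<omega>. ptail n \<omega> \<partial>M) \<le> (\<integral>\<^sup>+u. ennreal (count_bound u) * indicator {0<..} u \<partial>lborel)"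
    by (rule order_trans[OF nn_integral_path_tail_le], intro nn_integral_mono)
      (auto split: split_indicator intro: nn_integral_path_count_le)
  then show ?thesis using nn_integral_count_bound by (rule le_less_trans)
qed

text \<open>Dominated convergence in \<open>u\<close>: at each level the expected count is at most
  the tail of a convergent series, and \<open>count_bound\<close> dominates for every
  \<open>n\<close>.\<close>

lemma nn_integral_path_tail_tendsto_0: "(\<lambda>n. \<integral>\<^sup>+\<omega>. ptail n \<omega> \<partial>M) \<longlonglongrightarrow> 0"
proof -
  have lim: "(\<lambda>n. \<integral>\<^sup>+u. (\<integral>\<^sup>+\<omega>. pcount n u \<omega> \<partial>M) * indicator {0<..} u \<partial>lborel)
    \<longlonglongrightarrow> (\<integral>\<^sup>+u. 0 \<partial>(lborel :: real measure))"
  proof (rule nn_integral_dominated_convergence[where w = "\<lambda>u. ennreal (count_bound u) * indicator {0<..} u"])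
    have "(\<lambda>n. (\<integral>\<^sup>+\<omega>. pcount n u \<omega> \<partial>M) * indicator {0<..} u) \<longlonglongrightarrow> 0" for u
    proof (cases "0 < u")
      case True
      have "(\<Sum>j. ennreal (m ^ j) * mark_prob H u j) < \<infinity>"
        using suminf_mark_prob_le[OF True] by (simp add: le_less_trans)
      then have "(\<lambda>n. \<Sum>j. of_bool (n < j) * (ennreal (m ^ j) * mark_prob H u j)) \<longlonglongrightarrow> 0"
        by (rule suminf_tail_ennreal_tendsto_0)
      then have "(\<lambda>n. \<integral>\<^sup>+\<omega>. pcount n u \<omega> \<partial>M) \<longlonglongrightarrow> 0"
        by (rule tendsto_sandwich[OF _ _ tendsto_const, rotated 2])
          (auto intro: always_eventually nn_integral_path_count_le_tail)
      then show ?thesis using True by simp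
    qed simp
    then show "AE u in lborel. (\<lambda>n. (\<integral>\<^sup>+\<omega>. pcount n u \<omega> \<partial>M) * indicator {0<..} u) \<longlonglongrightarrow> 0" by simp
    show "(\<lambda>u. (\<integral>\<^sup>+\<omega>. pcount n u \<omega> \<partial>M) * indicator {0<..} u) \<in> borel_measurable lborel" for n
      by measurable
    show "(\<lambda>u. ennreal (count_bound u) * indicator {0<..} u) \<in> borel_measurable lborel"
      unfolding count_bound_def by measurable
    show "AE u in lborel. (\<integral>\<^sup>+\<omega>. pcount n u \<omega> \<partial>M) * indicator {0<..} u
        \<le> ennreal (count_bound u) * indicator {0<..} u" for n
      by (auto split: split_indicator intro: nn_integral_path_count_le)
  qed (use nn_integral_count_bound in auto)
  show ?thesis
    by (rule tendsto_sandwich[OF _ _ tendsto_const lim[simplified]])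
      (auto intro: always_eventually nn_integral_path_tail_le)
qed

text \<open>The tails decrease in \<open>n\<close>, so their limit is the infimum, which has
  expectation 0. Monotonicity upgrades convergence in mean to almost sure convergence without
  passing to a subsequence.\<close>

lemma AE_path_tail_tendsto_0: "AE \<omega> in M. (\<lambda>n. ptail n \<omega>) \<longlonglongrightarrow> 0"
proof -
  have "(\<integral>\<^sup>+\<omega>. (INF n. ptail n \<omega>) \<partial>M) \<le> (\<integral>\<^sup>+\<omega>. ptail n \<omega> \<partial>M)" for n
    by (intro nn_integral_mono INF_lower) simp
  then have "(\<integral>\<^sup>+\<omega>. (INF n. ptail n \<omega>) \<partial>M) \<le> 0"
    by (intro LIMSEQ_le_const[OF nn_integral_path_tail_tendsto_0]) auto
  then have "AE \<omega> in M. (INF n. ptail n \<omega>) = 0"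
    by (subst nn_integral_0_iff_AE[symmetric]) auto
  then show ?thesis
  proof eventually_elim
    case (elim \<omega>)
    have "(\<lambda>n. ptail n \<omega>) \<longlonglongrightarrow> (INF n. ptail n \<omega>)"
      by (rule LIMSEQ_INF) (simp add: decseq_def path_tail_antimono)
    then show ?case by (simp only: elim)
  qed
qed

end

subsection \<open>Passing to rays\<close>

lemma ray_sum_eq:
  assumes "t \<in> rays c"
  shows "(\<Sum>i<k. f (t (Suc (i + n)))) = (\<Sum>j\<in>{n<..n + k}. f (take j (t (n + k))))"
proof -
  have "(\<Sum>j\<in>{n<..n + k}. f (take j (t (n + k)))) = (\<Sum>j\<in>{n<..n + k}. f (t j))"
    by (intro sum.cong) (auto simp: rays_take[OF assms])
  also have "\<dots> = (\<Sum>i<k. f (t (Suc (i + n))))"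
    by (rule sum.reindex_bij_witness[of _ "\<lambda>i. Suc (i + n)" "\<lambda>j. j - Suc n"]) auto
  finally show ?thesis by simp
qed

text \<open>Each partial sum along the ray is a sum along the finite path to
  \<open>t (n + k)\<close>.\<close>

lemma ray_suminf_le_path_tail:
  assumes "t \<in> rays c"
  shows "(\<Sum>i. ennreal (x (t (Suc (i + n))))) \<le> path_tail c x n"
proof (rule suminf_le_const[OF summableI])
  fix k
  have "(\<Sum>i<k. ennreal (x (t (Suc (i + n))))) = (\<Sum>j\<in>{n<..length (t (n + k))}. ennreal (x (take j (t (n + k)))))"
    unfolding ray_sum_eq[OF assms, of "\<lambda>v. ennreal (x v)"] by (simp add: rays_length[OF assms])
  also have "t (n + k) \<in> gw_tree c" using assms by (simp add: rays_def)
  then have "(\<Sum>j\<in>{n<..length (t (n + k))}. ennreal (x (take j (t (n + k))))) \<le> path_tail c x n"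
    unfolding path_tail_def by (rule SUP_upper)
  finally show "(\<Sum>i<k. ennreal (x (t (Suc (i + n))))) \<le> path_tail c x n" .
qed

definition partial_sup :: "nat pmf \<Rightarrow> real \<Rightarrow> (nat list \<Rightarrow> nat) \<Rightarrow> (nat list \<Rightarrow> real) \<Rightarrow> nat \<Rightarrow> ennreal" where
  "partial_sup Z H c y n = (SUP v\<in>{v. survives c v \<and> length v = n}.
    ennreal \<bar>\<Sum>i<n. offspring_mean Z powr (- (real (Suc i) * H)) * y (take (Suc i) v)\<bar>)"

text \<open>Koenig's lemma, \<open>survives_imp_ray\<close>, is what makes the supremum over rays measurable: a partial
  sum only sees the countably many vertices with descendants in every generation.\<close>

lemma partial_sup_eq:
  "partial_sup Z H c y n = (SUP t\<in>rays c. ennreal \<bar>\<Sum>i<n. brw_term Z H y t i\<bar>)"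
proof -
  have eq: "(\<Sum>i<n. brw_term Z H y t i)
      = (\<Sum>i<n. offspring_mean Z powr (- (real (Suc i) * H)) * y (take (Suc i) (t n)))"
    if "t \<in> rays c" for t
    using that unfolding brw_term_def by (intro sum.cong refl) (simp add: rays_take)
  have image: "{v. survives c v \<and> length v = n} = (\<lambda>t. t n) ` rays c"
  proof (intro set_eqI iffI)
    fix v assume "v \<in> {v. survives c v \<and> length v = n}"
    then have "survives c v" "length v = n" by blast+
    from survives_imp_ray[OF this(1)] show "v \<in> (\<lambda>t. t n) ` rays c"
      unfolding \<open>length v = n\<close> by blast
  next
    fix v assume "v \<in> (\<lambda>t. t n) ` rays c"
    then obtain t where "t \<in> rays c" "v = t n" by blast
    then show "v \<in> {v. survives c v \<and> length v = n}"
      using ray_survives rays_length by blast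
  qed
  show ?thesis
    unfolding partial_sup_def image image_image by (intro SUP_cong refl) (simp only: eq)
qed

text \<open>One fixed realisation, hence purely deterministic. \<open>x\<close> is left free at the
  root, where \<open>abs_term\<close> is 0 whatever the increment.\<close>

locale brw_path =
  fixes Z :: "nat pmf" and H :: real and c :: "nat list \<Rightarrow> nat" and y :: "nat list \<Rightarrow> real"
    and x :: "nat list \<Rightarrow> real"
  assumes x: "v \<noteq> [] \<Longrightarrow> x v = \<bar>offspring_mean Z powr (- (real (length v) * H)) * y v\<bar>"
begin

lemma abs_brw_term:
  assumes "t \<in> rays c"
  shows "\<bar>brw_term Z H y t i\<bar> = x (t (Suc i))"
proof -
  have len: "length (t (Suc i)) = Suc i" using assms by (rule rays_length)
  then have "t (Suc i) \<noteq> []" by (metis list.size(3) nat.distinct(1))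
  from x[OF this] show ?thesis by (simp add: brw_term_def len)
qed

text \<open>A finite tail beyond \<open>n\<close> gives absolute convergence there, and finitely
  many earlier terms do not matter. The error bound is the same for all rays.\<close>

lemma
  assumes "t \<in> rays c" "path_tail c x n < \<infinity>"
  shows summable_brw_term: "summable (\<lambda>i. \<bar>brw_term Z H y t i\<bar>)"
    and brw_value_diff_le: "ennreal \<bar>brw_value Z H y t - (\<Sum>i<n. brw_term Z H y t i)\<bar> \<le> path_tail c x n"
proof -
  let ?f = "\<lambda>i. \<bar>brw_term Z H y t (i + n)\<bar>"
  have le: "(\<Sum>i. ennreal (?f i)) \<le> path_tail c x n"
    unfolding abs_brw_term[OF assms(1)] by (rule ray_suminf_le_path_tail[OF assms(1)])
  then have tail: "summable ?f"
    using assms(2) by (intro summable_suminf_not_top) (auto simp: top_unique)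
  then show sum: "summable (\<lambda>i. \<bar>brw_term Z H y t i\<bar>)" by (rule summable_iff_shift[THEN iffD1])
  have "brw_value Z H y t - (\<Sum>i<n. brw_term Z H y t i) = (\<Sum>i. brw_term Z H y t (i + n))"
    unfolding brw_value_def by (rule suminf_minus_initial_segment[OF summable_rabs_cancel[OF sum], symmetric])
  then have "ennreal \<bar>brw_value Z H y t - (\<Sum>i<n. brw_term Z H y t i)\<bar> \<le> ennreal (\<Sum>i. ?f i)"
    using summable_rabs[OF tail] by (simp add: ennreal_leI)
  also have "\<dots> = (\<Sum>i. ennreal (?f i))" by (rule suminf_ennreal2[symmetric]) (auto intro: tail)
  also note le
  finally show "ennreal \<bar>brw_value Z H y t - (\<Sum>i<n. brw_term Z H y t i)\<bar> \<le> path_tail c x n" .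
qed

text \<open>Triangle inequality ray by ray with the uniform error. Both directions are additive
  since subtraction in \<open>ennreal\<close> is truncated.\<close>

lemma
  assumes "path_tail c x n < \<infinity>"
  shows brw_sup_abs_le: "brw_sup_abs Z H c y \<le> partial_sup Z H c y n + path_tail c x n"
    and partial_sup_le: "partial_sup Z H c y n \<le> brw_sup_abs Z H c y + path_tail c x n"
proof -
  have triangle: "ennreal \<bar>a\<bar> \<le> s + r"
    if "ennreal \<bar>b\<bar> \<le> s" "ennreal \<bar>a - b\<bar> \<le> r" for a b :: real and r s
  proof -
    have "ennreal \<bar>a\<bar> \<le> ennreal \<bar>b\<bar> + ennreal \<bar>a - b\<bar>"
      by (subst ennreal_plus[symmetric]) (auto intro: ennreal_leI simp del: ennreal_plus)
    then show ?thesis using add_mono[OF that] by (rule order_trans)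
  qed
  note diff = brw_value_diff_le[OF _ assms]
  show "brw_sup_abs Z H c y \<le> partial_sup Z H c y n + path_tail c x n"
    unfolding brw_sup_abs_def partial_sup_eq
  proof (rule SUP_least)
    fix t assume t: "t \<in> rays c"
    show "ennreal \<bar>brw_value Z H y t\<bar>
        \<le> (SUP t\<in>rays c. ennreal \<bar>\<Sum>i<n. brw_term Z H y t i\<bar>) + path_tail c x n"
      by (rule triangle[OF _ diff[OF t]]) (rule SUP_upper[OF t])
  qed
  show "partial_sup Z H c y n \<le> brw_sup_abs Z H c y + path_tail c x n"
    unfolding brw_sup_abs_def partial_sup_eq
  proof (rule SUP_least)
    fix t assume t: "t \<in> rays c"
    show "ennreal \<bar>\<Sum>i<n. brw_term Z H y t i\<bar>
        \<le> (SUP t\<in>rays c. ennreal \<bar>brw_value Z H y t\<bar>) + path_tail c x n"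
      by (rule triangle[of "brw_value Z H y t"], rule SUP_upper[OF t])
        (simp only: abs_minus_commute[of _ "brw_value Z H y t"] diff[OF t])
  qed
qed

lemma brw_sup_abs_le_path_tail:
  assumes "path_tail c x 0 < \<infinity>"
  shows "brw_sup_abs Z H c y \<le> path_tail c x 0"
proof -
  \<comment> \<open>At \<open>n = 0\<close> all partial sums are empty, so the tail alone bounds the
    supremum.\<close>
  have "partial_sup Z H c y 0 = 0" unfolding partial_sup_eq by (auto intro!: antisym SUP_least)
  then show ?thesis using brw_sup_abs_le[OF assms] by simp
qed

lemma partial_sup_tendsto:
  assumes "path_tail c x 0 < \<infinity>" "path_tail c x \<longlonglongrightarrow> 0"
  shows "partial_sup Z H c y \<longlonglongrightarrow> brw_sup_abs Z H c y"
proof -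
  let ?S = "brw_sup_abs Z H c y"
  have fin: "path_tail c x n < \<infinity>" for n
    using path_tail_antimono[of 0 n c x] assms(1) by (simp add: le_less_trans)
  have S: "?S < \<infinity>" using brw_sup_abs_le_path_tail[OF assms(1)] assms(1) by (rule le_less_trans)
  \<comment> \<open>Finiteness of \<open>?S\<close> excludes the difference of two infinities, where
    subtraction is not continuous.\<close>
  have "(\<lambda>n. ?S - path_tail c x n) \<longlonglongrightarrow> ?S - 0"
    using S by (intro tendsto_diff_ennreal_general tendsto_const assms(2)) auto
  then have lower: "(\<lambda>n. ?S - path_tail c x n) \<longlonglongrightarrow> ?S" by simp
  have "(\<lambda>n. ?S + path_tail c x n) \<longlonglongrightarrow> ?S + 0"
    by (intro tendsto_add tendsto_const assms(2))
  then have upper: "(\<lambda>n. ?S + path_tail c x n) \<longlonglongrightarrow> ?S" by simp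
  have "?S - path_tail c x n \<le> partial_sup Z H c y n" for n
    using brw_sup_abs_le[OF fin[of n]] S by (auto simp: ennreal_minus_le_iff add.commute)
  moreover have "partial_sup Z H c y n \<le> ?S + path_tail c x n" for n
    by (rule partial_sup_le[OF fin])
  ultimately show ?thesis
    by (intro tendsto_sandwich[OF always_eventually always_eventually lower upper] allI)
qed

end

text \<open>Preimages under \<open>f\<close> and \<open>g\<close> differ only inside a null set, all
  of whose subsets are measurable in the completion.\<close>

lemma borel_measurable_completion_AE_eq:
  fixes f g :: "'a \<Rightarrow> ennreal"
  assumes g: "g \<in> borel_measurable M" and eq: "AE x in M. f x = g x"
  shows "f \<in> borel_measurable (completion M)"
proof -
  obtain A where A: "A \<in> null_sets M" "{x\<in>space M. f x \<noteq> g x} \<subseteq> A"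
    using eq by (auto elim!: AE_E simp: null_sets_def)
  show ?thesis
  proof (rule measurableI)
    fix B :: "ennreal set" assume B: "B \<in> sets borel"
    let ?S = "g -` B \<inter> space M"
    have S: "?S \<in> sets (completion M)" using g B by (auto intro: measurable_sets)
    have null: "f -` B \<inter> space M \<inter> A \<in> sets (completion M)"
      by (rule null_setsD2, rule null_sets_completion_subset[OF _ null_sets_completionI[OF A(1)]]) auto
    have split: "f -` B \<inter> space M = (?S - A) \<union> (f -` B \<inter> space M \<inter> A)" using A(2) by auto
    have "A \<in> sets (completion M)" using A(1) by auto
    then show "f -` B \<inter> space (completion M) \<in> sets (completion M)"
      unfolding space_completion by (subst split) (rule sets.Un[OF sets.Diff[OF S] null])
  qed simp
qed

section \<open>Measurability and integrability of the random supremum\<close>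

context discounted_brw_moment
begin

lemma brw_path: "brw_path Z H (\<lambda>v. \<eta> v \<omega>) (abs_term H \<omega>)"
  by unfold_locales (simp add: abs_term_def abs_mult)

lemma partial_sup_measurable [measurable]:
  "(\<lambda>\<omega>. partial_sup Z H (\<lambda>v. N v \<omega>) (\<lambda>v. \<eta> v \<omega>) n) \<in> borel_measurable M"
proof -
  have [measurable]: "Measurable.pred M (\<lambda>\<omega>. survives (\<lambda>v. N v \<omega>) v)" for v
    unfolding survives_def by measurable
  define g where "g v \<omega> = ennreal \<bar>\<Sum>i<n. m powr (- (real (Suc i) * H)) * \<eta> (take (Suc i) v) \<omega>\<bar>" for v \<omega>
  \<comment> \<open>With \<open>length v = n\<close> every prefix in the sum is a non-root label;
    \<open>v = []\<close> with \<open>n > 0\<close> would bring in \<open>\<eta> []\<close>, which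
    need not be measurable.\<close>
  have g: "g v \<in> borel_measurable M" if "length v = n" for v
  proof -
    have [measurable]: "\<eta> (take (Suc i) v) \<in> borel_measurable M" if "i < n" for i
      using that \<open>length v = n\<close> by (intro increment_measurable) auto
    show ?thesis unfolding g_def by measurable
  qed
  have term_measurable: "(\<lambda>\<omega>. if survives (\<lambda>v. N v \<omega>) v \<and> length v = n then g v \<omega> else 0)
      \<in> borel_measurable M" for v
  proof (cases "length v = n")
    case True
    from g[OF this] show ?thesis unfolding True by (intro measurable_If) simp_all
  next
    case False
    then show ?thesis by simp
  qed
  have "partial_sup Z H (\<lambda>v. N v \<omega>) (\<lambda>v. \<eta> v \<omega>) n
      = (SUP v. if survives (\<lambda>v. N v \<omega>) v \<and> length v = n then g v \<omega> else 0)" for \<omega>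
    unfolding partial_sup_def g_def by (subst SUP_if_mem) (simp only: mem_Collect_eq)
  then show ?thesis
    by (simp only:) (intro borel_measurable_SUP term_measurable countableI_type)
qed

lemma brw_sup_abs_integrable:
  shows "AE \<omega> in M. \<forall>t\<in>rays (\<lambda>v. N v \<omega>). summable (brw_term Z H (\<lambda>v. \<eta> v \<omega>) t)" (is ?summable)
    and "(\<lambda>\<omega>. brw_sup_abs Z H (\<lambda>v. N v \<omega>) (\<lambda>v. \<eta> v \<omega>)) \<in> borel_measurable (completion M)" (is ?measurable)
    and "(\<integral>\<^sup>+ \<omega>. brw_sup_abs Z H (\<lambda>v. N v \<omega>) (\<lambda>v. \<eta> v \<omega>) \<partial>completion M) < \<infinity>" (is ?integral)
proof -
  have fin: "AE \<omega> in M. ptail 0 \<omega> < \<infinity>"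
    using nn_integral_PInf_AE[OF path_tail_measurable[of 0]] nn_integral_path_tail_less_top[of 0]
    by (simp add: less_top)
  then show ?summable
  proof eventually_elim
    case (elim \<omega>)
    then show ?case
      using brw_path.summable_brw_term[OF brw_path] summable_rabs_cancel by blast
  qed
  \<comment> \<open>The upper limit of the partial suprema is measurable everywhere, and it equals
    the supremum wherever the tails are finite and vanish.\<close>
  have "AE \<omega> in M. brw_sup_abs Z H (\<lambda>v. N v \<omega>) (\<lambda>v. \<eta> v \<omega>)
      = limsup (partial_sup Z H (\<lambda>v. N v \<omega>) (\<lambda>v. \<eta> v \<omega>))"
    using fin AE_path_tail_tendsto_0
  proof eventually_elim
    case (elim \<omega>)
    then show ?case
      using lim_imp_Limsup[OF _ brw_path.partial_sup_tendsto[OF brw_path]] by simp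
  qed
  then show ?measurable
    by (rule borel_measurable_completion_AE_eq[rotated]) measurable
  have "(\<integral>\<^sup>+ \<omega>. brw_sup_abs Z H (\<lambda>v. N v \<omega>) (\<lambda>v. \<eta> v \<omega>) \<partial>completion M) \<le> (\<integral>\<^sup>+ \<omega>. ptail 0 \<omega> \<partial>M)"
    unfolding nn_integral_completion
    by (rule nn_integral_mono_AE, use fin in eventually_elim)
      (rule brw_path.brw_sup_abs_le_path_tail[OF brw_path])
  then show ?integral using nn_integral_path_tail_less_top by (rule le_less_trans)
qed

end

text \<open>Summability ensures that \<open>brw_value\<close> is a genuine sum and not the default
  of a divergent series. Measurability in the completion makes the integral a genuine expectation,
  although the rays may be uncountable.\<close>

theorem proposition2:
  fixes H :: real and Z :: "nat pmf" and P :: "'p measure" and Y :: "'p \<Rightarrow> real"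
    and M :: "'a measure" and N :: "nat list \<Rightarrow> 'a \<Rightarrow> nat" and \<eta> :: "nat list \<Rightarrow> 'a \<Rightarrow> real"
  assumes "0 < H" and "H < 1"
    and "offspring_mean Z > 1"
    and "\<exists>q. q > max (1 / H) 1 \<and> integrable (measure_pmf Z) (\<lambda>n. real n powr q)"
    and "prob_space P" and "Y \<in> borel_measurable P"
    and "integrable P (\<lambda>x. \<bar>Y x\<bar> powr (1 / H))"
    and "discounted_brw M Z (distr P borel Y) N \<eta>"
  shows "(AE \<omega> in M. \<forall>t\<in>rays (\<lambda>v. N v \<omega>). summable (brw_term Z H (\<lambda>v. \<eta> v \<omega>) t))
    \<and> (\<lambda>\<omega>. brw_sup_abs Z H (\<lambda>v. N v \<omega>) (\<lambda>v. \<eta> v \<omega>)) \<in> borel_measurable (completion M)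
    \<and> (\<integral>\<^sup>+ \<omega>. brw_sup_abs Z H (\<lambda>v. N v \<omega>) (\<lambda>v. \<eta> v \<omega>) \<partial>completion M) < \<infinity>"
proof -
  interpret discounted_brw M Z "distr P borel Y" N \<eta> by fact
  have "(\<integral>\<^sup>+y. ennreal (\<bar>y\<bar> powr (1 / H)) \<partial>distr P borel Y) = (\<integral>\<^sup>+x. ennreal (\<bar>Y x\<bar> powr (1 / H)) \<partial>P)"
    using assms(6) by (intro nn_integral_distr) simp_all
  also have "\<dots> < \<infinity>"
    using assms(7) by (simp add: integrable_iff_bounded)
  finally interpret discounted_brw_moment M Z "distr P borel Y" N \<eta> H
    using assms by unfold_locales
  show ?thesis by (intro conjI brw_sup_abs_integrable)
qed

end
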